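(* Let $\alpha_M\in[0,1)$. With $H^{\alpha_M}_{x_0}(\omega_0,x)$ the transverse profile of the refocused wave in the homogeneous waveguide defined in the context, in the continuum limit $N(\omega_0)\gg1$ (i.e. $\omega_0\to+\infty$) one has, for every $\tilde x\in\mathbb{R}$, \[ \lim_{\omega_0 \to +\infty}\frac{\lambda_{oc}^{1-\alpha_M}}{\theta}H^{\alpha_M}_{x_0}\Big(\omega_0,x_0+\frac{\lambda_{oc}}{\theta}\tilde{x}\Big)=\frac{\tilde{d}_2+\tilde{d}_1}{d}\,\mathrm{sinc}(2\pi\tilde{x}). \] The width of the focal spot is therefore given by the diffraction limit $\lambda_{oc}/(2\theta)$ (the first zeros of the limit profile are at $\tilde x=\pm 1/2$, i.e. at distance $\lambda_{oc}/(2\theta)$ from $x_0$).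
   Context: $\mathrm{sinc}(s)=\sin(s)/s$. Fixed parameters: ocean depth $d>0$, index of refraction $n_1>1$ in the ocean section $[0,d]$ (and $1$ for $x>d$), $\theta=\sqrt{1-1/n_1^2}$, sound speed $c>0$, source depth $x_0\in(0,d)$. For a carrier frequency $\omega_0>0$: $k(\omega_0)=\omega_0/c$ and $\lambda_{oc}=2\pi c/(n_1\omega_0)$ (carrier wavelength in the ocean). Propagating modes. $N=N(\omega_0)$ is the number of solutions $0<\sigma_1(\omega_0)<\dots<\sigma_{N}(\omega_0)<n_1k(\omega_0)d\theta$ of $\tan y=-y/\sqrt{(n_1k(\omega_0)d\theta)^2-y^2}$ on $(0,n_1k(\omega_0)d\theta)$. Put $\zeta_j=\sqrt{(n_1k(\omega_0)d\theta)^2-\sigma_j^2}$, \[A_j(\omega_0)=\sqrt{\frac{2/d}{1+\frac{\sin^2 \sigma_j}{\zeta_j}-\frac{\sin(2 \sigma_j)}{2\sigma_j}}},\] and $\phi_j(\omega_0,x)=A_j\sin(\sigma_jx/d)$ for $0\le x\le d$, $\phi_j(\omega_0,x)=A_j\sin(\sigma_j)e^{-\zeta_j(x-d)/d}$ for $x\ge d$. Mirror. The time-reversal mirror occupies $[d_1,d_2]\subset[0,d]$ with $d_2=d_M+\lambda_{oc}^{\alpha_M}\tilde d_2$, $d_1=d_M-\lambda_{oc}^{\alpha_M}\tilde d_1$, $d_M\in(0,d)$, $\tilde d_1,\tilde d_2>0$ fixed, and \[M_{jj}(\omega_0)=(d_2-d_1)A_j^2(\omega_0)\Big[1-\cos\Big(\sigma_j\frac{d_2+d_1}{d}\Big)\mathrm{sinc}\Big(\sigma_j\frac{d_2-d_1}{d}\Big)\Big].\]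 Transverse profile of the refocused wave in a homogeneous waveguide: \[H^{\alpha_M}_{x_0}(\omega_0,x)=\frac14\sum_{j=1}^{N(\omega_0)}M_{jj}(\omega_0)\,\phi_j(\omega_0,x_0)\,\phi_j(\omega_0,x).\] *)

theory Defs
  imports "HOL-Probability.Probability"
begin

text \<open>
  Parameters, in the order used below: sound speed \<open>c\<close>, index of refraction \<open>n1\<close>, ocean depth \<open>d\<close>,
  and carrier frequency \<open>\<omega>\<close>.  The function \<open>sinc\<close> is the one of \<open>HOL-Probability.Sinc_Integral\<close>,
  with \<open>sinc 0 = 1\<close>.
\<close>

definition theta :: "real \<Rightarrow> real" where
  "theta n1 = sqrt (1 - 1 / n1\<^sup>2)"

definition wavenumber :: "real \<Rightarrow> real \<Rightarrow> real" where
  "wavenumber c \<omega> = \<omega> / c"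

definition lambda_oc :: "real \<Rightarrow> real \<Rightarrow> real \<Rightarrow> real" where
  "lambda_oc c n1 \<omega> = 2 * pi * c / (n1 * \<omega>)"

definition mode_bound :: "real \<Rightarrow> real \<Rightarrow> real \<Rightarrow> real \<Rightarrow> real" where
  "mode_bound c n1 d \<omega> = n1 * wavenumber c \<omega> * d * theta n1"

text \<open>
  At the poles of \<open>tan\<close> HOL has \<open>tan y = 0\<close>, whereas the right-hand side below is strictly negative,
  so this convention creates no spurious solutions.
\<close>

definition mode_solutions :: "real \<Rightarrow> real \<Rightarrow> real \<Rightarrow> real \<Rightarrow> real set" where
  "mode_solutions c n1 d \<omega> =
     {y. 0 < y \<and> y < mode_bound c n1 d \<omega> \<and>
         tan y = - y / sqrt ((mode_bound c n1 d \<omega>)\<^sup>2 - y\<^sup>2)}"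

definition num_modes :: "real \<Rightarrow> real \<Rightarrow> real \<Rightarrow> real \<Rightarrow> nat" where
  "num_modes c n1 d \<omega> = card (mode_solutions c n1 d \<omega>)"

text \<open>
  The solution set is finite (each branch of \<open>tan\<close> contains at most one solution), so for
  \<open>1 \<le> j \<le> num_modes c n1 d \<omega>\<close> the following is its \<open>j\<close>-th smallest element.
\<close>

definition sigma :: "real \<Rightarrow> real \<Rightarrow> real \<Rightarrow> real \<Rightarrow> nat \<Rightarrow> real" where
  "sigma c n1 d \<omega> j = sorted_list_of_set (mode_solutions c n1 d \<omega>) ! (j - 1)"

definition zeta :: "real \<Rightarrow> real \<Rightarrow> real \<Rightarrow> real \<Rightarrow> nat \<Rightarrow> real" where
  "zeta c n1 d \<omega> j = sqrt ((mode_bound c n1 d \<omega>)\<^sup>2 - (sigma c n1 d \<omega> j)\<^sup>2)"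

definition amplitude :: "real \<Rightarrow> real \<Rightarrow> real \<Rightarrow> real \<Rightarrow> nat \<Rightarrow> real" where
  "amplitude c n1 d \<omega> j =
     (let s = sigma c n1 d \<omega> j
      in sqrt ((2 / d) / (1 + (sin s)\<^sup>2 / zeta c n1 d \<omega> j - sin (2 * s) / (2 * s))))"

text \<open>The waveguide is the half-line \<open>x \<ge> 0\<close>; the values of the mode profiles for \<open>x < 0\<close> carry no meaning.\<close>

definition mode_profile :: "real \<Rightarrow> real \<Rightarrow> real \<Rightarrow> real \<Rightarrow> nat \<Rightarrow> real \<Rightarrow> real" where
  "mode_profile c n1 d \<omega> j x =
     (let s = sigma c n1 d \<omega> j; A = amplitude c n1 d \<omega> j
      in if x \<le> d then A * sin (s * x / d)
         else A * sin s * exp (- (zeta c n1 d \<omega> j) * (x - d) / d))"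

text \<open>
  The mirror is the interval from \<open>mirror_lower\<close> to \<open>mirror_upper\<close>; \<open>e1\<close> and \<open>e2\<close> are its scaled
  half-widths below and above the centre \<open>dM\<close>, and \<open>\<alpha>\<close> is the scaling exponent.
\<close>

definition mirror_lower :: "real \<Rightarrow> real \<Rightarrow> real \<Rightarrow> real \<Rightarrow> real \<Rightarrow> real \<Rightarrow> real" where
  "mirror_lower c n1 \<alpha> dM e1 \<omega> = dM - lambda_oc c n1 \<omega> powr \<alpha> * e1"

definition mirror_upper :: "real \<Rightarrow> real \<Rightarrow> real \<Rightarrow> real \<Rightarrow> real \<Rightarrow> real \<Rightarrow> real" where
  "mirror_upper c n1 \<alpha> dM e2 \<omega> = dM + lambda_oc c n1 \<omega> powr \<alpha> * e2"

definition mirror_coeff ::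
    "real \<Rightarrow> real \<Rightarrow> real \<Rightarrow> real \<Rightarrow> real \<Rightarrow> real \<Rightarrow> real \<Rightarrow> real \<Rightarrow> nat \<Rightarrow> real" where
  "mirror_coeff c n1 d \<alpha> dM e1 e2 \<omega> j =
     (let d1 = mirror_lower c n1 \<alpha> dM e1 \<omega>;
          d2 = mirror_upper c n1 \<alpha> dM e2 \<omega>;
          s = sigma c n1 d \<omega> j
      in (d2 - d1) * (amplitude c n1 d \<omega> j)\<^sup>2 *
           (1 - cos (s * ((d2 + d1) / d)) * sinc (s * ((d2 - d1) / d))))"

definition refocused_profile ::
    "real \<Rightarrow> real \<Rightarrow> real \<Rightarrow> real \<Rightarrow> real \<Rightarrow> real \<Rightarrow> real \<Rightarrow> real \<Rightarrow> real \<Rightarrow> real \<Rightarrow> real" where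
  "refocused_profile c n1 d \<alpha> dM e1 e2 x0 \<omega> x =
     1 / 4 * (\<Sum>j = 1..num_modes c n1 d \<omega>.
       mirror_coeff c n1 d \<alpha> dM e1 e2 \<omega> j *
       mode_profile c n1 d \<omega> j x0 * mode_profile c n1 d \<omega> j x)"

end

theory Submission
  imports Defs
begin

text \<open>
  Put \<open>B = n\<^sub>1 k d \<theta>\<close>, so that the number of modes is about \<open>B / \<pi>\<close> and \<open>B \<lambda> = 2 \<pi> d \<theta>\<close>.  The argument rests
  on an exact description of the modes: \<open>\<sigma>\<^sub>j = B sin p\<^sub>j = j \<pi> - p\<^sub>j\<close> with angles \<open>p\<^sub>j\<close> that increase inside
  \<open>(0, \<pi> / 2)\<close> (lemmas \<open>mode_angle\<close>, \<open>mode_solutions_eq\<close>).  In particular \<open>\<zeta>\<^sub>j = B cos p\<^sub>j\<close>, and the squared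
  amplitude is exactly \<open>2 / d * \<zeta>\<^sub>j / (1 + \<zeta>\<^sub>j)\<close> (\<open>amplitude_squared\<close>).

  If all amplitudes were \<open>sqrt (2 / d)\<close> and all mirror brackets were \<open>1\<close>, the rescaled profile would be a
  constant times
  \<open>1 / B * (\<Sum>j. sin (\<sigma>\<^sub>j x\<^sub>0 / d) * sin (\<sigma>\<^sub>j x\<^sub>0 / d + 2 \<pi> t \<sigma>\<^sub>j / B))\<close>.
  The product of sines is half of \<open>cos (2 \<pi> t \<sigma>\<^sub>j / B) - cos (2 \<sigma>\<^sub>j x\<^sub>0 / d + 2 \<pi> t \<sigma>\<^sub>j / B)\<close>.  The first cosine gives
  a Riemann sum for the integral of \<open>cos (2 \<pi> t u)\<close> over \<open>[0, 1]\<close>, that is, \<open>sinc (2 \<pi> t)\<close>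
  (\<open>riemann_sum_bounded\<close>).  The second one oscillates from mode to mode because \<open>0 < 2 x\<^sub>0 / d < 2\<close>, and its
  sum stays bounded by Abel summation, since the angles have total variation at most \<open>\<pi> / 2\<close>
  (\<open>oscillating_sum_bounded\<close>).

  The errors committed are negligible against \<open>B\<close>.  The amplitude defects \<open>1 / (1 + \<zeta>\<^sub>j)\<close> have a bounded
  sum, again by telescoping the angles (\<open>sum_amplitude_defect\<close>).  The mirror brackets differ from \<open>1\<close> by at
  most \<open>\<bar>sinc (\<sigma>\<^sub>j m)\<bar>\<close> with \<open>m\<close> of order \<open>\<lambda> powr \<alpha>\<close>, and the sum of these is at most of order \<open>sqrt (B / m)\<close>
  (\<open>sum_sinc_le\<close>), which is \<open>o(B)\<close> because \<open>\<alpha> < 1\<close>.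
\<close>

section \<open>Parametrisation of the modes by an angle\<close>

text \<open>
  The largest integer strictly below \<open>B / \<pi> + 1 / 2\<close>; this is the number of modes (\<open>num_modes_eq\<close>).
\<close>

definition mode_count :: "real \<Rightarrow> nat" where
  "mode_count B = nat \<lceil>B / pi - 1 / 2\<rceil>"

text \<open>
  Writing a solution as \<open>B sin p\<close> turns its partner \<open>sqrt (B\<^sup>2 - \<sigma>\<^sup>2)\<close> into \<open>B cos p\<close> and the mode
  equation into \<open>tan (B sin p) = - tan p\<close>, that is, \<open>sin (B sin p + p) = 0\<close>.  The angle \<open>p\<close> is used
  rather than \<open>\<sigma> / B\<close> because \<open>\<sigma> = j \<pi> - p\<close> splits \<open>\<sigma>\<close> into an arithmetic progression and a correction
  that is monotone in \<open>j\<close> and bounded by \<open>\<pi> / 2\<close>.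
\<close>

definition mode_angle :: "real \<Rightarrow> nat \<Rightarrow> real" where
  "mode_angle B j = (THE p. 0 < p \<and> p < pi / 2 \<and> B * sin p + p = real j * pi)"

text \<open>
  On \<open>(0, \<pi> / 2)\<close> the phase \<open>B sin p + p\<close> takes exactly the values in \<open>(0, B + \<pi> / 2)\<close>, so the right-hand
  side says when branch \<open>j\<close> carries a mode.
\<close>

lemma le_mode_count_iff:
  assumes "B > 0"
  shows "j \<le> mode_count B \<longleftrightarrow> j = 0 \<or> real j * pi < B + pi / 2"
proof (cases "j = 0")
  case False
  have "j \<le> mode_count B \<longleftrightarrow> int j \<le> \<lceil>B / pi - 1 / 2\<rceil>"
    using False unfolding mode_count_def by linarith
  also have "\<dots> \<longleftrightarrow> real j - 1 < B / pi - 1 / 2"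
    by (simp add: le_ceiling_iff)
  also have "\<dots> \<longleftrightarrow> real j * pi < B + pi / 2"
    by (simp add: field_simps)
  finally show ?thesis using False by simp
qed simp

lemma mode_count_bounds:
  assumes "B > 0"
  shows "\<bar>real (mode_count B) * pi - B\<bar> \<le> pi / 2"
proof -
  have "real (mode_count B) * pi < B + pi / 2"
    using le_mode_count_iff[OF assms, of "mode_count B"] assms
    by (cases "mode_count B = 0") (auto simp: add_pos_pos)
  moreover have "\<not> real (Suc (mode_count B)) * pi < B + pi / 2"
    using le_mode_count_iff[OF assms, of "Suc (mode_count B)"] by auto
  ultimately show ?thesis
    unfolding of_nat_Suc distrib_right by linarith
qed

lemma mode_count_le:
  assumes "B \<ge> 1"
  shows "real (mode_count B) \<le> B"
proof -
  have "real (mode_count B) * pi \<le> B + pi / 2"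
    using mode_count_bounds[of B] assms by linarith
  also have "\<dots> \<le> B * pi"
  proof -
    have "B * (pi - 1) \<ge> 1 * (pi - 1)"
      using assms pi_gt3 by (intro mult_right_mono) auto
    moreover have "pi / 2 \<le> pi - 1" using pi_gt3 by simp
    ultimately show ?thesis by (simp add: algebra_simps)
  qed
  finally show ?thesis by simp
qed

lemma angle_phase_strict_mono:
  fixes p q :: real
  assumes "B > 0" "0 \<le> p" "p < q" "q \<le> pi / 2"
  shows "B * sin p + p < B * sin q + q"
proof -
  have "sin p < sin q" using assms by (intro sin_monotone_2pi) auto
  then show ?thesis using assms(1,3) mult_strict_left_mono[of "sin p" "sin q" B] by linarith
qed

lemma mode_angle_ex1:
  assumes "B > 0" "1 \<le> j" "real j * pi < B + pi / 2"
  shows "\<exists>!p. 0 < p \<and> p < pi / 2 \<and> B * sin p + p = real j * pi"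
proof -
  have "\<exists>p\<ge>0. p \<le> pi / 2 \<and> B * sin p + p = real j * pi"
    using assms by (intro IVT') (auto intro!: continuous_intros)
  then obtain p where p: "0 \<le> p" "p \<le> pi / 2" "B * sin p + p = real j * pi" by blast
  have "p \<noteq> 0" using p(3) assms(2) by auto
  moreover have "p \<noteq> pi / 2"
  proof
    assume "p = pi / 2"
    then have "sin p = 1" using sin_pi_half by metis
    then show False using p(3) assms(3) \<open>p = pi / 2\<close> by simp
  qed
  ultimately have p': "0 < p \<and> p < pi / 2 \<and> B * sin p + p = real j * pi" using p by auto
  have "q = p" if "0 < q \<and> q < pi / 2 \<and> B * sin q + q = real j * pi" for q
    using angle_phase_strict_mono[OF assms(1), of p q]
      angle_phase_strict_mono[OF assms(1), of q p] that p'
    by (cases p q rule: linorder_cases) auto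
  then show ?thesis using p' by blast
qed

lemma mode_angle:
  assumes "B > 0" "j \<in> {1..mode_count B}"
  shows "0 < mode_angle B j" "mode_angle B j < pi / 2"
    "B * sin (mode_angle B j) + mode_angle B j = real j * pi"
proof -
  have "real j * pi < B + pi / 2" using le_mode_count_iff[of B j] assms by auto
  with theI'[OF mode_angle_ex1[of B j]] assms
  show "0 < mode_angle B j" "mode_angle B j < pi / 2"
    "B * sin (mode_angle B j) + mode_angle B j = real j * pi"
    unfolding mode_angle_def by auto
qed

lemma mode_angle_eqI:
  assumes "B > 0" "0 < p" "p < pi / 2" "B * sin p + p = real j * pi"
  shows "j \<in> {1..mode_count B}" "mode_angle B j = p"
proof -
  have "real j * pi > 0" using assms sin_gt_zero[of p] by (simp flip: assms(4) add: add_pos_pos)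
  then have j: "1 \<le> j" by (cases j) auto
  have "real j * pi < B + pi / 2"
    using assms by (simp flip: assms(4)) (use mult_left_mono[OF sin_le_one, of B p] in linarith)
  then show "j \<in> {1..mode_count B}" "mode_angle B j = p"
    using le_mode_count_iff[of B j] j assms the1_equality[OF mode_angle_ex1[of B j], of p]
    unfolding mode_angle_def by auto
qed

lemma mode_angle_strict_mono:
  assumes "B > 0" "i \<in> {1..mode_count B}" "j \<in> {1..mode_count B}" "i < j"
  shows "mode_angle B i < mode_angle B j"
proof (rule ccontr)
  assume "\<not> ?thesis"
  then have "B * sin (mode_angle B j) + mode_angle B j \<le> B * sin (mode_angle B i) + mode_angle B i"
    using angle_phase_strict_mono[OF assms(1), of "mode_angle B j" "mode_angle B i"]
      mode_angle[OF assms(1)] assms(2,3)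
    by (cases "mode_angle B j = mode_angle B i") (auto simp: less_imp_le)
  then show False using mode_angle(3)[OF assms(1)] assms by auto
qed

text \<open>
  After multiplication by the two cosines, the equation says \<open>sin y cos p + cos y sin p = 0\<close>, where
  \<open>y = B sin p\<close>.  The case \<open>cos y = 0\<close> needs separate treatment because there \<open>tan y = 0\<close> by convention;
  both sides of the equivalence are then false.
\<close>

lemma mode_equation_iff:
  assumes "B > 0" "0 < p" "p < pi / 2"
  shows "tan (B * sin p) = - (B * sin p) / sqrt (B\<^sup>2 - (B * sin p)\<^sup>2)
    \<longleftrightarrow> sin (B * sin p + p) = 0"
proof -
  let ?y = "B * sin p"
  have cp: "cos p > 0" using assms by (intro cos_gt_zero_pi) auto
  have sp: "sin p > 0" using assms by (intro sin_gt_zero) auto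
  have "B\<^sup>2 - ?y\<^sup>2 = (B * cos p)\<^sup>2"
    by (simp add: power_mult_distrib cos_squared_eq right_diff_distrib)
  then have z: "sqrt (B\<^sup>2 - ?y\<^sup>2) = B * cos p" using assms cp by simp
  show ?thesis
  proof (cases "cos ?y = 0")
    case True
    then have "tan ?y = 0" by (simp add: tan_def)
    moreover have "sin ?y \<noteq> 0" using True sin_zero_abs_cos_one[of ?y] by force
    ultimately show ?thesis unfolding z using True assms sp cp by (auto simp: sin_add)
  next
    case False
    then show ?thesis unfolding z using assms sp cp
      by (auto simp: sin_add tan_def field_simps)
  qed
qed

lemma mode_solutions_eq:
  fixes c n1 d \<omega> :: real
  defines "B \<equiv> mode_bound c n1 d \<omega>"
  assumes "B > 0"
  shows "mode_solutions c n1 d \<omega> = (\<lambda>j. B * sin (mode_angle B j)) ` {1..mode_count B}"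
proof (intro set_eqI iffI)
  fix y assume "y \<in> mode_solutions c n1 d \<omega>"
  then have y: "0 < y" "y < B" "tan y = - y / sqrt (B\<^sup>2 - y\<^sup>2)"
    unfolding mode_solutions_def B_def by auto
  define p where "p = arcsin (y / B)"
  have q: "0 < y / B" "y / B < 1" using y assms(2) by auto
  have p: "0 < p" "p < pi / 2" "y = B * sin p"
    using q arcsin_less_arcsin[of 0 "y / B"] arcsin_less_arcsin[of "y / B" 1] assms(2)
    unfolding p_def by auto
  have "sin (B * sin p + p) = 0" using mode_equation_iff[OF assms(2) p(1,2)] y(3) p(3) by simp
  then obtain i where i: "B * sin p + p = of_int i * pi" by (auto simp: sin_zero_iff_int2)
  have "of_int i * pi > 0" using p y by (simp flip: i)
  then have "i > 0" by (simp add: zero_less_mult_iff)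
  then have "B * sin p + p = real (nat i) * pi" using i by simp
  from mode_angle_eqI[OF assms(2) p(1,2) this] p(3)
  show "y \<in> (\<lambda>j. B * sin (mode_angle B j)) ` {1..mode_count B}" by force
next
  fix y assume "y \<in> (\<lambda>j. B * sin (mode_angle B j)) ` {1..mode_count B}"
  then obtain j where j: "j \<in> {1..mode_count B}" "y = B * sin (mode_angle B j)" by auto
  note p = mode_angle[OF assms(2) j(1)]
  have "sin (mode_angle B j) < 1" using p(1,2) sin_monotone_2pi[of "mode_angle B j" "pi/2"] by auto
  moreover have "sin (mode_angle B j) > 0" using p(1,2) by (intro sin_gt_zero) auto
  moreover have "sin (B * sin (mode_angle B j) + mode_angle B j) = 0" unfolding p(3) by simp
  ultimately show "y \<in> mode_solutions c n1 d \<omega>"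
    using mode_equation_iff[OF assms(2) p(1,2)] assms(2)
    unfolding mode_solutions_def B_def j(2) by auto
qed

section \<open>Ordered enumeration and amplitudes of the modes\<close>

lemma sorted_list_of_set_strict_mono_image:
  fixes f :: "nat \<Rightarrow> real"
  assumes "\<And>i j. i \<in> {1..n} \<Longrightarrow> j \<in> {1..n} \<Longrightarrow> i < j \<Longrightarrow> f i < f j"
  shows "sorted_list_of_set (f ` {1..n}) = map f [1..<Suc n]"
proof -
  have "sorted_wrt (<) [1..<Suc n]" by (rule sorted_wrt_upt)
  then have "sorted_wrt (<) (map f [1..<Suc n])"
    unfolding sorted_wrt_map
    by (rule sorted_wrt_mono_rel[rotated]) (use assms in \<open>auto simp del: upt_Suc\<close>)
  moreover have "set (map f [1..<Suc n]) = f ` {1..n}" by (auto simp: atLeastLessThanSuc_atLeastAtMost)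
  ultimately show ?thesis
    using sorted_list_of_set.idem_if_sorted_distinct[of "map f [1..<Suc n]"]
    by (metis strict_sorted_iff)
qed

lemma mode_families:
  fixes c n1 d \<omega> :: real
  defines "B \<equiv> mode_bound c n1 d \<omega>"
  assumes "B > 0"
  shows num_modes_eq: "num_modes c n1 d \<omega> = mode_count B"
    and sigma_eq: "\<And>j. j \<in> {1..mode_count B} \<Longrightarrow> sigma c n1 d \<omega> j = B * sin (mode_angle B j)"
proof -
  let ?f = "\<lambda>j. B * sin (mode_angle B j)"
  have mono: "?f i < ?f j" if "i \<in> {1..mode_count B}" "j \<in> {1..mode_count B}" "i < j" for i j
    using mode_angle_strict_mono[OF assms(2) that] mode_angle(1)[OF assms(2) that(1)]
      mode_angle(2)[OF assms(2) that(2)] assms(2)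
    by (intro mult_strict_left_mono sin_monotone_2pi) auto
  then have inj: "inj_on ?f {1..mode_count B}" by (intro linorder_inj_onI) (force, auto)
  show "num_modes c n1 d \<omega> = mode_count B"
    using card_image[OF inj] mode_solutions_eq[of c n1 d \<omega>] assms(2)
    unfolding num_modes_def B_def by simp
  fix j assume "j \<in> {1..mode_count B}"
  then show "sigma c n1 d \<omega> j = B * sin (mode_angle B j)"
    using sorted_list_of_set_strict_mono_image[of "mode_count B" ?f, OF mono]
      mode_solutions_eq[of c n1 d \<omega>] assms(2)
    unfolding sigma_def B_def by (auto simp del: upt_Suc)
qed

lemma zeta_eq:
  assumes "mode_bound c n1 d \<omega> = B" "B > 0" "j \<in> {1..mode_count B}"
  shows "zeta c n1 d \<omega> j = B * cos (mode_angle B j)"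
proof -
  have "cos (mode_angle B j) > 0"
    using mode_angle[OF assms(2,3)] by (intro cos_gt_zero_pi) auto
  moreover have "B\<^sup>2 - (B * sin (mode_angle B j))\<^sup>2 = (B * cos (mode_angle B j))\<^sup>2"
    by (simp add: power_mult_distrib cos_squared_eq right_diff_distrib)
  ultimately show ?thesis
    unfolding zeta_def assms(1) using sigma_eq[of c n1 d \<omega> j] assms by simp
qed

text \<open>
  Since \<open>\<sigma> = j \<pi> - p\<close>, one has \<open>sin\<^sup>2 \<sigma> = sin\<^sup>2 p\<close> and \<open>sin (2 \<sigma>) = - 2 sin p cos p\<close>; the two corrections in
  the denominator of the amplitude are \<open>sin\<^sup>2 p / (B cos p)\<close> and \<open>cos p / B\<close>, and they add up to
  \<open>1 / (B cos p) = 1 / \<zeta>\<close> exactly.  So the squared amplitude is \<open>2 / d\<close> up to the relative defect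
  \<open>1 / (1 + \<zeta>)\<close>.
\<close>

lemma amplitude_squared:
  assumes "mode_bound c n1 d \<omega> = B" "B > 0" "d > 0" "j \<in> {1..mode_count B}"
  shows "(amplitude c n1 d \<omega> j)\<^sup>2 = 2 / d * (1 - 1 / (1 + B * cos (mode_angle B j)))"
proof -
  let ?p = "mode_angle B j" and ?s = "B * sin (mode_angle B j)"
  note p = mode_angle[OF assms(2,4)]
  have cp: "cos ?p > 0" using p by (intro cos_gt_zero_pi) auto
  have sp: "sin ?p > 0" using p by (intro sin_gt_zero) auto
  have s: "?s = real j * pi - ?p" using p(3) by simp
  have ss: "(sin ?s)\<^sup>2 = (sin ?p)\<^sup>2"
    unfolding s by (simp add: sin_diff power_mult_distrib flip: power_mult)
  have "2 * ?s = - (2 * ?p) + real j * (2 * pi)" unfolding s by simp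
  then have "sin (2 * ?s) = sin (- (2 * ?p) + real j * (2 * pi))" by (rule arg_cong)
  also have "\<dots> = sin (- (2 * ?p))" using sin.plus_of_nat[of "- (2 * ?p)" j] by simp
  finally have s2: "sin (2 * ?s) = - 2 * sin ?p * cos ?p" by (simp only: sin_minus sin_double)
  have "1 + (sin ?s)\<^sup>2 / (B * cos ?p) - sin (2 * ?s) / (2 * ?s)
      = 1 + ((sin ?p)\<^sup>2 + (cos ?p)\<^sup>2) / (B * cos ?p)"
    unfolding ss s2 using sp cp assms(2) by (simp add: field_simps power2_eq_square)
  also have "\<dots> = 1 + 1 / (B * cos ?p)" by simp
  finally have D: "1 + (sin ?s)\<^sup>2 / (B * cos ?p) - sin (2 * ?s) / (2 * ?s) = 1 + 1 / (B * cos ?p)" .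
  have pos: "B * cos ?p > 0" using assms cp by simp
  have "(amplitude c n1 d \<omega> j)\<^sup>2 = 2 / d / (1 + 1 / (B * cos ?p))"
    unfolding amplitude_def Let_def zeta_eq[OF assms(1,2,4)]
      sigma_eq[of c n1 d \<omega> j, unfolded assms(1), OF assms(2,4)] D
    using pos assms(3) by (intro real_sqrt_pow2) (auto intro!: divide_nonneg_nonneg add_nonneg_nonneg)
  also have "\<dots> = 2 / d * (1 - 1 / (1 + B * cos ?p))"
  proof -
    have "2 / d / (1 + 1 / x) = 2 / d * (1 - 1 / (1 + x))" if "x > 0" for x :: real
      using that assms(3) by (simp add: divide_simps)
    then show ?thesis using pos by blast
  qed
  finally show ?thesis .
qed

lemma mode_angle_variation:
  assumes "B > 0"
  shows "(\<Sum>j\<in>{1..<mode_count B}. mode_angle B (Suc j) - mode_angle B j) \<le> pi / 2"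
proof (cases "mode_count B = 0")
  case False
  then have "(\<Sum>j\<in>{1..<mode_count B}. mode_angle B (Suc j) - mode_angle B j)
      = mode_angle B (mode_count B) - mode_angle B 1"
    by (intro sum_Suc_diff') auto
  then show ?thesis
    using mode_angle[OF assms, of 1] mode_angle[OF assms, of "mode_count B"] False by auto
qed simp

text \<open>
  The defect is large only for the few modes with small \<open>\<zeta>\<close>, and its total over all modes stays
  bounded.  Between consecutive modes the phase \<open>B sin p + p\<close> grows by \<open>\<pi>\<close>, while its slope is at most
  \<open>1 + B cos p\<^sub>j = 1 + \<zeta>\<^sub>j\<close>; hence \<open>1 / (1 + \<zeta>\<^sub>j)\<close> is at most the gap of the angles divided by \<open>\<pi>\<close>.
  The gaps telescope to at most \<open>\<pi> / 2\<close>, and the last mode adds at most \<open>1\<close>.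
\<close>

lemma sum_amplitude_defect:
  assumes "B > 0"
  shows "(\<Sum>j = 1..mode_count B. 1 / (1 + B * cos (mode_angle B j))) \<le> 3 / 2"
proof (cases "mode_count B = 0")
  case False
  define N where "N = mode_count B"
  let ?p = "mode_angle B"
  let ?g = "\<lambda>j. 1 / (1 + B * cos (?p j))"
  have cp: "cos (?p j) > 0" if "j \<in> {1..N}" for j
    using mode_angle[OF assms, of j] that unfolding N_def by (intro cos_gt_zero_pi) auto
  have step: "?g j \<le> (?p (Suc j) - ?p j) / pi" if j: "j \<in> {1..<N}" for j
  proof -
    have m: "j \<in> {1..mode_count B}" "Suc j \<in> {1..mode_count B}" using j unfolding N_def by auto
    note p = mode_angle[OF assms m(1)] and q = mode_angle[OF assms m(2)]
    have lt: "?p j < ?p (Suc j)" using mode_angle_strict_mono[OF assms m] by simp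
    obtain x where x: "?p j < x" "x < ?p (Suc j)"
      "sin (?p (Suc j)) - sin (?p j) = (?p (Suc j) - ?p j) * cos x"
      using MVT2[OF lt, of sin cos] by (auto intro: DERIV_sin)
    have "cos x \<le> cos (?p j)"
      using x p q by (intro cos_monotone_0_pi_le) auto
    then have "sin (?p (Suc j)) - sin (?p j) \<le> (?p (Suc j) - ?p j) * cos (?p j)"
      unfolding x(3) using lt by (intro mult_left_mono) auto
    then have "B * (sin (?p (Suc j)) - sin (?p j)) \<le> B * ((?p (Suc j) - ?p j) * cos (?p j))"
      using assms by (intro mult_left_mono) auto
    moreover have "B * sin (?p (Suc j)) + ?p (Suc j) = B * sin (?p j) + ?p j + pi"
      using p(3) q(3) by (simp add: distrib_right)
    ultimately have "pi \<le> (?p (Suc j) - ?p j) * (1 + B * cos (?p j))"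
      by (simp add: algebra_simps)
    moreover have "1 + B * cos (?p j) > 0" using cp[of j] j assms by (auto intro: add_pos_pos)
    ultimately show ?thesis by (simp add: field_simps)
  qed
  have "(\<Sum>j = 1..N. ?g j) = (\<Sum>j\<in>{1..<N}. ?g j) + ?g N"
    using False unfolding N_def by (simp add: sum.last_plus)
  also have "(\<Sum>j\<in>{1..<N}. ?g j) \<le> (\<Sum>j\<in>{1..<N}. (?p (Suc j) - ?p j) / pi)"
    by (intro sum_mono step)
  also have "\<dots> \<le> 1 / 2"
    using mode_angle_variation[OF assms]
    unfolding sum_divide_distrib[symmetric] N_def by (simp add: field_simps)
  also have "?g N \<le> 1" using cp[of N] False assms unfolding N_def by (auto simp: divide_le_eq_1)
  finally show ?thesis unfolding N_def by simp
qed simp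

section \<open>Sums of phases over the modes\<close>

text \<open>
  Multiplication by \<open>1 - z\<close> telescopes the sum up to boundary terms and the increments of \<open>w\<close>.  For
  \<open>z \<noteq> 1\<close> the sum is therefore controlled by the variation of the weights and not by their number.
\<close>

lemma abel_summation_bound:
  fixes z :: complex and w :: "nat \<Rightarrow> complex"
  assumes "norm z = 1" and w: "\<And>j. j \<in> {1..n} \<Longrightarrow> norm (w j) \<le> 1"
  shows "norm (1 - z) * norm (\<Sum>j = 1..n. z ^ j * w j)
    \<le> 2 + (\<Sum>j\<in>{1..<n}. norm (w (Suc j) - w j))"
proof (cases n)
  case (Suc m)
  have id: "(1 - z) * (\<Sum>j = 1..Suc m. z ^ j * w j) = z * w 1 - z ^ (Suc (Suc m)) * w (Suc m)
      + (\<Sum>j\<in>{1..<Suc m}. z ^ Suc j * (w (Suc j) - w j))" for m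
  proof (induction m)
    case (Suc m)
    have e: "{1..Suc (Suc m)} = insert (Suc (Suc m)) {1..Suc m}"
      "{1..<Suc (Suc m)} = insert (Suc m) {1..<Suc m}" by auto
    show ?case unfolding e
      by (subst (1 2) sum.insert) (simp_all only: distrib_left Suc.IH, auto simp: algebra_simps)
  qed (simp add: algebra_simps)
  have "norm (1 - z) * norm (\<Sum>j = 1..n. z ^ j * w j)
      = norm (z * w 1 - z ^ (Suc n) * w n + (\<Sum>j\<in>{1..<n}. z ^ Suc j * (w (Suc j) - w j)))"
    unfolding norm_mult[symmetric] Suc id ..
  also have "\<dots> \<le> norm (z * w 1) + norm (z ^ (Suc n) * w n)
      + norm (\<Sum>j\<in>{1..<n}. z ^ Suc j * (w (Suc j) - w j))"
    by (meson norm_triangle_ineq norm_triangle_ineq4 order_trans add_right_mono)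
  also have "norm (\<Sum>j\<in>{1..<n}. z ^ Suc j * (w (Suc j) - w j))
      \<le> (\<Sum>j\<in>{1..<n}. norm (w (Suc j) - w j))"
    by (rule sum_norm_le) (simp only: norm_mult norm_power assms(1), simp)
  also have "norm (z * w 1) \<le> 1" using w[of 1] assms(1) Suc by (simp add: norm_mult)
  also have "norm (z ^ (Suc n) * w n) \<le> 1"
    using w[of n] Suc by (simp only: norm_mult norm_power assms(1)) simp
  finally show ?thesis by simp
qed simp

lemma norm_cis_diff_le: "norm (cis x - cis y) \<le> \<bar>x - y\<bar>"
proof -
  have "cis x - cis y = cis y * (cis (x - y) - 1)" by (simp add: algebra_simps cis_mult)
  then have "norm (cis x - cis y) = norm (cis (x - y) - 1)" by (simp add: norm_mult)
  also have "\<dots> \<le> \<bar>x - y\<bar>"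
    using iexp_approx1[of "x - y" 0] by (simp add: cis_conv_exp)
  finally show ?thesis .
qed

lemma abs_sin_diff_le: "\<bar>sin x - sin y\<bar> \<le> \<bar>x - y :: real\<bar>"
proof -
  have "\<bar>Im (cis x - cis y)\<bar> \<le> \<bar>x - y\<bar>"
    using abs_Im_le_cmod norm_cis_diff_le order_trans by blast
  then show ?thesis by simp
qed

lemma abs_cos_diff_le: "\<bar>cos x - cos y\<bar> \<le> \<bar>x - y :: real\<bar>"
proof -
  have "\<bar>Re (cis x - cis y)\<bar> \<le> \<bar>x - y\<bar>"
    using abs_Re_le_cmod norm_cis_diff_le order_trans by blast
  then show ?thesis by simp
qed

text \<open>
  With \<open>\<sigma>\<^sub>j = j \<pi> - p\<^sub>j\<close> the summand is the real part of \<open>z ^ j * w\<^sub>j\<close>, where \<open>z = cis (a \<pi>)\<close> and \<open>w\<^sub>j\<close> depends on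
  \<open>p\<^sub>j\<close> alone, in a Lipschitz way.  The angles increase inside \<open>[0, \<pi> / 2]\<close>, so the weights have bounded
  variation, uniformly in \<open>B\<close>.  The hypotheses on \<open>a\<close> guarantee \<open>z \<noteq> 1\<close>.
\<close>

lemma oscillating_sum_bounded:
  assumes "0 < a" "a < 2"
  shows "\<exists>K. \<forall>B>0. \<bar>\<Sum>j = 1..mode_count B.
    cos (a * (B * sin (mode_angle B j)) + b * sin (mode_angle B j))\<bar> \<le> K"
proof (intro exI allI impI)
  fix B :: real assume B: "B > 0"
  define z where "z = cis (a * pi)"
  define w where "w j = cis (b * sin (mode_angle B j) - a * mode_angle B j)" for j
  let ?p = "mode_angle B" and ?N = "mode_count B"
  have "cos (a * pi) \<noteq> 1"
  proof
    assume "cos (a * pi) = 1"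
    then obtain i :: int where "a * pi = of_int i * 2 * pi" by (auto simp: cos_one_2pi_int)
    then have "a = of_int (2 * i)" by simp
    moreover have "0 < i" "i < 1" using assms calculation by simp_all
    ultimately show False by linarith
  qed
  then have z: "norm (1 - z) > 0" unfolding z_def by (auto simp: complex_eq_iff)
  have summand: "cos (a * (B * sin (?p j)) + b * sin (?p j)) = Re (z ^ j * w j)" if "j \<in> {1..?N}" for j
  proof -
    have s: "B * sin (?p j) = real j * pi - ?p j" using mode_angle(3)[OF B that] by simp
    have "a * (B * sin (?p j)) + b * sin (?p j)
        = real j * (a * pi) + (b * sin (?p j) - a * ?p j)" unfolding s by (simp add: algebra_simps)
    then have "cis (a * (B * sin (?p j)) + b * sin (?p j)) = z ^ j * w j"
      unfolding z_def w_def by (simp only: Complex.DeMoivre cis_mult)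
    then show ?thesis by (metis cis.sel(1))
  qed
  have var: "norm (w (Suc j) - w j) \<le> (\<bar>b\<bar> + a) * (?p (Suc j) - ?p j)" if "j \<in> {1..<?N}" for j
  proof -
    have lt: "?p j < ?p (Suc j)" using that by (intro mode_angle_strict_mono[OF B]) auto
    have "norm (w (Suc j) - w j) \<le> \<bar>b * (sin (?p (Suc j)) - sin (?p j)) - a * (?p (Suc j) - ?p j)\<bar>"
      unfolding w_def by (rule order_trans[OF norm_cis_diff_le]) (simp add: algebra_simps)
    also have "\<dots> \<le> \<bar>b\<bar> * \<bar>sin (?p (Suc j)) - sin (?p j)\<bar> + a * (?p (Suc j) - ?p j)"
      using lt assms by (intro order_trans[OF abs_triangle_ineq4]) (simp add: abs_mult)
    also have "\<bar>b\<bar> * \<bar>sin (?p (Suc j)) - sin (?p j)\<bar> \<le> \<bar>b\<bar> * (?p (Suc j) - ?p j)"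
      using abs_sin_diff_le[of "?p (Suc j)" "?p j"] lt by (intro mult_left_mono) auto
    finally show ?thesis by (simp add: algebra_simps)
  qed
  have "norm (1 - z) * norm (\<Sum>j = 1..?N. z ^ j * w j)
      \<le> 2 + (\<Sum>j\<in>{1..<?N}. norm (w (Suc j) - w j))"
    by (rule abel_summation_bound) (auto simp: z_def w_def)
  also have "(\<Sum>j\<in>{1..<?N}. norm (w (Suc j) - w j))
      \<le> (\<bar>b\<bar> + a) * (\<Sum>j\<in>{1..<?N}. ?p (Suc j) - ?p j)"
    unfolding sum_distrib_left by (intro sum_mono var)
  also have "\<dots> \<le> (\<bar>b\<bar> + a) * (pi / 2)"
    using mode_angle_variation[OF B] assms by (intro mult_left_mono) auto
  finally have "norm (\<Sum>j = 1..?N. z ^ j * w j) \<le> (2 + (\<bar>b\<bar> + a) * (pi / 2)) / norm (1 - z)"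
    using z by (simp add: field_simps)
  moreover have "(\<Sum>j = 1..?N. cos (a * (B * sin (?p j)) + b * sin (?p j)))
      = Re (\<Sum>j = 1..?N. z ^ j * w j)"
    unfolding Re_sum by (intro sum.cong refl summand)
  ultimately show "\<bar>\<Sum>j = 1..?N. cos (a * (B * sin (?p j)) + b * sin (?p j))\<bar>
      \<le> (2 + (\<bar>b\<bar> + a) * (pi / 2)) / norm (1 - cis (a * pi))"
    using abs_Re_le_cmod order_trans unfolding z_def by metis
qed

text \<open>
  The points \<open>sin p\<^sub>j = \<sigma>\<^sub>j / B\<close> lie in consecutive cells of length \<open>\<pi> / B\<close>, so this is a tagged Riemann sum
  for the integral of \<open>cos (b u)\<close> over \<open>[0, 1]\<close>, which is \<open>sinc b\<close>.
\<close>

lemma riemann_sum_bounded: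
  assumes B: "B \<ge> 1"
  shows "\<bar>(\<Sum>j = 1..mode_count B. cos (b * sin (mode_angle B j))) - B / pi * sinc b\<bar>
    \<le> pi * \<bar>b\<bar> + 1 / 2"
proof -
  \<comment> \<open>The antiderivative of \<open>cos (b u)\<close> that vanishes at \<open>0\<close>.\<close>
  define Q :: "real \<Rightarrow> real" where "Q u = (if b = 0 then u else sin (b * u) / b)" for u
  have dQ: "(Q has_real_derivative cos (b * u)) (at u)" for u
    unfolding Q_def by (cases "b = 0") (auto intro!: derivative_eq_intros)
  have Q0: "Q 0 = 0" and Q1: "Q 1 = sinc b" unfolding Q_def by auto
  define h where "h = pi / B"
  have h: "h > 0" using B unfolding h_def by simp
  let ?p = "mode_angle B" and ?N = "mode_count B"
  have summand: "\<bar>cos (b * sin (?p j)) - B / pi * (Q (real j * h) - Q ((real j - 1) * h))\<bar> \<le> \<bar>b\<bar> * h"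
    if j: "j \<in> {1..?N}" for j
  proof -
    have p: "0 < ?p j" "?p j < pi / 2" "B * sin (?p j) + ?p j = real j * pi"
      using mode_angle[of B j] j B by auto
    have lt: "(real j - 1) * h < real j * h" using h by simp
    obtain x where x: "(real j - 1) * h < x" "x < real j * h"
      "Q (real j * h) - Q ((real j - 1) * h) = (real j * h - (real j - 1) * h) * cos (b * x)"
      using MVT2[OF lt, of Q "\<lambda>u. cos (b * u)"] dQ by auto
    have "B / pi * (Q (real j * h) - Q ((real j - 1) * h)) = cos (b * x)"
      unfolding x(3) using B by (simp add: h_def algebra_simps)
    moreover have "sin (?p j) = real j * h - ?p j / B"
      using p(3) B unfolding h_def by (simp add: field_simps)
    moreover have "0 < ?p j / B" "?p j / B < h"
      using p B unfolding h_def by (auto intro!: divide_strict_right_mono)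
    ultimately have e: "B / pi * (Q (real j * h) - Q ((real j - 1) * h)) = cos (b * x)"
      "\<bar>sin (?p j) - x\<bar> \<le> h" using x(1,2) by (auto simp: algebra_simps)
    have "\<bar>cos (b * sin (?p j)) - cos (b * x)\<bar> \<le> \<bar>b * sin (?p j) - b * x\<bar>"
      by (rule abs_cos_diff_le)
    also have "\<dots> = \<bar>b\<bar> * \<bar>sin (?p j) - x\<bar>" by (simp add: abs_mult flip: right_diff_distrib)
    also have "\<dots> \<le> \<bar>b\<bar> * h" using e(2) by (intro mult_left_mono) auto
    finally show ?thesis unfolding e(1) .
  qed
  have tele: "(\<Sum>j = 1..n. Q (real j * h) - Q ((real j - 1) * h)) = Q (real n * h)" for n
    by (induction n) (auto simp: Q0)
  have "\<bar>(\<Sum>j = 1..?N. cos (b * sin (?p j))) - B / pi * Q (real ?N * h)\<bar>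
      = \<bar>\<Sum>j = 1..?N. cos (b * sin (?p j)) - B / pi * (Q (real j * h) - Q ((real j - 1) * h))\<bar>"
    unfolding sum_subtractf sum_distrib_left[symmetric] tele[unfolded sum_subtractf] ..
  also have "\<dots> \<le> (\<Sum>j = 1..?N. \<bar>b\<bar> * h)"
    by (intro order_trans[OF sum_abs] sum_mono summand)
  also have "\<dots> = real ?N * (\<bar>b\<bar> * h)" by simp
  also have "\<dots> \<le> B * (\<bar>b\<bar> * h)"
    using mode_count_le[OF B] h by (intro mult_right_mono) auto
  also have "\<dots> = pi * \<bar>b\<bar>" using B unfolding h_def by simp
  finally have 1: "\<bar>(\<Sum>j = 1..?N. cos (b * sin (?p j))) - B / pi * Q (real ?N * h)\<bar> \<le> pi * \<bar>b\<bar>" .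
  have "\<bar>Q (real ?N * h) - Q 1\<bar> \<le> 1 * \<bar>real ?N * h - 1\<bar>"
    using field_differentiable_bound[of UNIV Q "\<lambda>u. cos (b * u)" 1 "real ?N * h" 1] dQ by auto
  also have "\<dots> = \<bar>real ?N * pi - B\<bar> / B"
  proof -
    have "real ?N * h - 1 = (real ?N * pi - B) / B"
      using B unfolding h_def by (simp add: diff_divide_distrib)
    then show ?thesis using B by (simp add: abs_divide)
  qed
  also have "\<dots> \<le> (pi / 2) / B"
    using mode_count_bounds[of B] B by (intro divide_right_mono) auto
  finally have "B / pi * \<bar>Q (real ?N * h) - Q 1\<bar> \<le> B / pi * ((pi / 2) / B)"
    using B by (intro mult_left_mono) auto
  also have "\<dots> = 1 / 2" using B by simp
  also have "B / pi * \<bar>Q (real ?N * h) - Q 1\<bar> = \<bar>B / pi * (Q (real ?N * h) - Q 1)\<bar>"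
    using B by (simp add: abs_mult)
  finally have 2: "\<bar>B / pi * Q (real ?N * h) - B / pi * Q 1\<bar> \<le> 1 / 2"
    by (simp only: right_diff_distrib)
  show ?thesis using 1 2 unfolding Q1 by linarith
qed


section \<open>Perturbation by amplitudes and mirror coefficients\<close>

lemma sum_inverse_sqrt_le: "(\<Sum>j = 1..n. 1 / sqrt (real j)) \<le> 2 * sqrt (real n)"
proof (induction n)
  case (Suc n)
  have "1 = (sqrt (real (Suc n)) - sqrt (real n)) * (sqrt (real (Suc n)) + sqrt (real n))"
    by (simp add: algebra_simps flip: power2_eq_square)
  also have "\<dots> \<le> (sqrt (real (Suc n)) - sqrt (real n)) * (2 * sqrt (real (Suc n)))"
    by (intro mult_left_mono) auto
  finally have "1 / sqrt (real (Suc n)) \<le> 2 * (sqrt (real (Suc n)) - sqrt (real n))"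
    by (simp add: field_simps)
  then show ?case using Suc by simp
qed simp

text \<open>
  A single bound that covers both \<open>\<bar>sinc x\<bar> \<le> 1\<close> for small \<open>x\<close> and \<open>\<bar>sinc x\<bar> \<le> 1 / x\<close> for large \<open>x\<close>, so that
  the sum over the modes needs no splitting.
\<close>

lemma abs_sinc_le_inverse_sqrt:
  assumes "x > 0"
  shows "\<bar>sinc x\<bar> \<le> 1 / sqrt x"
proof -
  have "\<bar>sin x\<bar> \<le> sqrt x"
  proof (cases "x \<le> 1")
    case True
    have "\<bar>sin x\<bar> \<le> x" using abs_sin_x_le_abs_x[of x] assms by simp
    also have "x \<le> sqrt x" using True assms by (intro real_le_rsqrt) (simp add: power2_eq_square mult_left_le)
    finally show ?thesis .
  next
    case False
    then show ?thesis using abs_sin_le_one[of x] by (meson order_trans real_sqrt_ge_one le_cases)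
  qed
  then have "\<bar>sin x\<bar> / x \<le> sqrt x / x" using assms by (intro divide_right_mono) auto
  also have "sqrt x / x = 1 / sqrt x" using assms by (simp add: field_simps)
  finally show ?thesis using assms by simp
qed

text \<open>
  Branch \<open>j\<close> has \<open>\<sigma>\<^sub>j \<ge> (j - 1 / 2) \<pi> \<ge> j\<close>, so the sum is dominated by the sum of \<open>1 / sqrt (j m)\<close>.  This is \<open>o(B)\<close>
  as soon as \<open>B m\<close> tends to infinity, that is, as soon as the mirror is much larger than the wavelength.
\<close>

lemma sum_sinc_le:
  assumes B: "B \<ge> 1" and m: "m > 0"
  shows "(\<Sum>j = 1..mode_count B. \<bar>sinc (B * sin (mode_angle B j) * m)\<bar>) \<le> 2 * sqrt (B / m)"
proof -
  let ?s = "\<lambda>j. B * sin (mode_angle B j)"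
  have "\<bar>sinc (?s j * m)\<bar> \<le> 1 / sqrt (real j) / sqrt m" if j: "j \<in> {1..mode_count B}" for j
  proof -
    have "?s j \<ge> real j * pi - pi / 2" using mode_angle[of B j] j B by auto
    moreover have "real j * (pi - 1) \<ge> 1 * (pi - 1)"
      using j pi_gt3 by (intro mult_right_mono) auto
    ultimately have s: "?s j \<ge> real j" using pi_gt3 by (simp add: algebra_simps)
    have j0: "real j > 0" using j by simp
    with s have "?s j > 0" by linarith
    then have "?s j * m > 0" using m by (rule mult_pos_pos)
    then have "\<bar>sinc (?s j * m)\<bar> \<le> 1 / sqrt (?s j * m)" by (rule abs_sinc_le_inverse_sqrt)
    also have "\<dots> \<le> 1 / sqrt (real j * m)"
      using s j0 m by (intro divide_left_mono real_sqrt_le_mono mult_right_mono) auto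
    finally show ?thesis by (simp add: real_sqrt_mult)
  qed
  then have "(\<Sum>j = 1..mode_count B. \<bar>sinc (?s j * m)\<bar>)
      \<le> (\<Sum>j = 1..mode_count B. 1 / sqrt (real j)) / sqrt m"
    unfolding sum_divide_distrib by (rule sum_mono)
  also have "\<dots> \<le> 2 * sqrt (real (mode_count B)) / sqrt m"
    using sum_inverse_sqrt_le m by (intro divide_right_mono) auto
  also have "\<dots> \<le> 2 * sqrt B / sqrt m"
    using mode_count_le[OF B] m by (intro divide_right_mono mult_left_mono real_sqrt_le_mono) auto
  finally show ?thesis by (simp add: real_sqrt_divide)
qed

text \<open>
  The product of sines is half the difference of a slowly varying cosine, whose sum is at most of order \<open>B\<close>, and
  a cosine that oscillates from mode to mode, whose sum stays bounded.
\<close>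

lemma sine_product_sum:
  assumes "0 < x" "x < 1"
  shows "\<exists>K. \<forall>B\<ge>1. \<bar>(\<Sum>j = 1..mode_count B. sin (B * sin (mode_angle B j) * x) *
      sin (B * sin (mode_angle B j) * x + b * sin (mode_angle B j))) - B / (2 * pi) * sinc b\<bar> \<le> K"
proof -
  obtain K where K: "\<And>B. B > 0 \<Longrightarrow> \<bar>\<Sum>j = 1..mode_count B.
      cos (2 * x * (B * sin (mode_angle B j)) + b * sin (mode_angle B j))\<bar> \<le> K"
    using oscillating_sum_bounded[of "2 * x" b] assms by auto
  have "\<bar>(\<Sum>j = 1..mode_count B. sin (B * sin (mode_angle B j) * x) *
      sin (B * sin (mode_angle B j) * x + b * sin (mode_angle B j))) - B / (2 * pi) * sinc b\<bar>
      \<le> (pi * \<bar>b\<bar> + 1 / 2) / 2 + K / 2" if B: "B \<ge> 1" for B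
  proof -
    let ?p = "mode_angle B"
    let ?R = "\<Sum>j = 1..mode_count B. cos (b * sin (?p j))"
    let ?O = "\<Sum>j = 1..mode_count B. cos (2 * x * (B * sin (?p j)) + b * sin (?p j))"
    have "sin (B * sin (?p j) * x) * sin (B * sin (?p j) * x + b * sin (?p j))
      = (cos (b * sin (?p j)) - cos (2 * x * (B * sin (?p j)) + b * sin (?p j))) / 2" for j
      unfolding sin_times_sin by (simp add: algebra_simps)
    then have e: "(\<Sum>j = 1..mode_count B. sin (B * sin (?p j) * x) *
        sin (B * sin (?p j) * x + b * sin (?p j))) = ?R / 2 - ?O / 2"
      by (simp only: sum_divide_distrib[symmetric] sum_subtractf diff_divide_distrib)
    have "B / (2 * pi) * sinc b = (B / pi * sinc b) / 2" by simp
    moreover have "\<bar>?R - B / pi * sinc b\<bar> \<le> pi * \<bar>b\<bar> + 1 / 2" "\<bar>?O\<bar> \<le> K"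
      using riemann_sum_bounded[OF B, of b] K[of B] B by auto
    ultimately show ?thesis unfolding e by argo
  qed
  then show ?thesis by blast
qed

text \<open>
  The amplitudes and the mirror coefficients perturb the weight \<open>1\<close> of a mode by at most
  \<open>2 / (1 + \<zeta>) + \<bar>sinc (\<sigma> m)\<bar>\<close>, and both contributions have been summed above.  The cosine that contains
  the position of the mirror enters only through \<open>\<bar>cos\<bar> \<le> 1\<close>, which gives uniformity in \<open>C\<close>.
\<close>

lemma weighted_mode_sum:
  assumes "0 < x" "x < 1"
  shows "\<exists>K. \<forall>B\<ge>1. \<forall>m>0. \<forall>C. \<bar>(\<Sum>j = 1..mode_count B.
      (1 - 1 / (1 + B * cos (mode_angle B j)))\<^sup>2 *
      (1 - cos (B * sin (mode_angle B j) * C) * sinc (B * sin (mode_angle B j) * m)) *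
      (sin (B * sin (mode_angle B j) * x) *
       sin (B * sin (mode_angle B j) * x + b * sin (mode_angle B j)))) - B / (2 * pi) * sinc b\<bar>
    \<le> K + 2 * sqrt (B / m)"
proof -
  obtain K where K: "\<And>B. B \<ge> 1 \<Longrightarrow> \<bar>(\<Sum>j = 1..mode_count B. sin (B * sin (mode_angle B j) * x) *
      sin (B * sin (mode_angle B j) * x + b * sin (mode_angle B j))) - B / (2 * pi) * sinc b\<bar> \<le> K"
    using sine_product_sum[OF assms] by blast
  have "\<bar>(\<Sum>j = 1..mode_count B. (1 - 1 / (1 + B * cos (mode_angle B j)))\<^sup>2 *
      (1 - cos (B * sin (mode_angle B j) * C) * sinc (B * sin (mode_angle B j) * m)) *
      (sin (B * sin (mode_angle B j) * x) *
       sin (B * sin (mode_angle B j) * x + b * sin (mode_angle B j)))) - B / (2 * pi) * sinc b\<bar>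
    \<le> (K + 3) + 2 * sqrt (B / m)" if B: "B \<ge> 1" and m: "m > 0" for B m C
  proof -
    define N where "N = mode_count B"
    define r where "r j = 1 / (1 + B * cos (mode_angle B j))" for j
    define u where "u j = cos (B * sin (mode_angle B j) * C)" for j
    define v where "v j = sinc (B * sin (mode_angle B j) * m)" for j
    define P where "P j = sin (B * sin (mode_angle B j) * x) *
       sin (B * sin (mode_angle B j) * x + b * sin (mode_angle B j))" for j
    have weight_error: "\<bar>(1 - r j)\<^sup>2 * (1 - u j * v j) * P j - P j\<bar> \<le> 2 * r j + \<bar>v j\<bar>"
      if j: "j \<in> {1..N}" for j
    proof -
      have "cos (mode_angle B j) > 0"
        using mode_angle[of B j] j B unfolding N_def by (intro cos_gt_zero_pi) auto
      then have r: "0 \<le> r j" "r j \<le> 1" using B unfolding r_def by (auto simp: divide_le_eq_1)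
      then have q: "(1 - r j)\<^sup>2 \<le> 1" by (simp add: power_le_one)
      have "1 - (1 - r j)\<^sup>2 \<le> 2 * r j" by (simp add: power2_eq_square algebra_simps)
      then have 1: "\<bar>(1 - r j)\<^sup>2 - 1\<bar> \<le> 2 * r j" using q by simp
      have "\<bar>(1 - r j)\<^sup>2 * u j\<bar> \<le> 1"
        unfolding abs_mult u_def using q by (intro mult_le_one) auto
      then have 2: "\<bar>(1 - r j)\<^sup>2 * u j * v j\<bar> \<le> \<bar>v j\<bar>"
        using mult_right_mono[of "\<bar>(1 - r j)\<^sup>2 * u j\<bar>" 1 "\<bar>v j\<bar>"] by (simp add: abs_mult)
      have P: "\<bar>P j\<bar> \<le> 1" unfolding P_def abs_mult by (intro mult_le_one) auto
      have "(1 - r j)\<^sup>2 * (1 - u j * v j) * P j - P j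
          = ((1 - r j)\<^sup>2 - 1 - (1 - r j)\<^sup>2 * u j * v j) * P j" by (simp add: algebra_simps)
      then have "\<bar>(1 - r j)\<^sup>2 * (1 - u j * v j) * P j - P j\<bar>
          \<le> \<bar>(1 - r j)\<^sup>2 - 1 - (1 - r j)\<^sup>2 * u j * v j\<bar> * 1"
        using mult_left_mono[OF P abs_ge_zero] by (simp only: abs_mult)
      moreover have "\<bar>(1 - r j)\<^sup>2 - 1 - (1 - r j)\<^sup>2 * u j * v j\<bar> \<le> 2 * r j + \<bar>v j\<bar>"
        using 1 2 by (intro order_trans[OF abs_triangle_ineq4]) (rule add_mono)
      ultimately show ?thesis by simp
    qed
    have "\<bar>(\<Sum>j = 1..N. (1 - r j)\<^sup>2 * (1 - u j * v j) * P j) - (\<Sum>j = 1..N. P j)\<bar>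
        \<le> (\<Sum>j = 1..N. 2 * r j + \<bar>v j\<bar>)"
      unfolding sum_subtractf[symmetric] by (intro order_trans[OF sum_abs] sum_mono weight_error)
    also have "\<dots> = 2 * (\<Sum>j = 1..N. r j) + (\<Sum>j = 1..N. \<bar>v j\<bar>)"
      by (simp add: sum.distrib sum_distrib_left)
    also have "\<dots> \<le> 2 * (3 / 2) + 2 * sqrt (B / m)"
      unfolding r_def v_def N_def
      using B by (intro add_mono mult_left_mono sum_amplitude_defect sum_sinc_le m) auto
    finally have "\<bar>(\<Sum>j = 1..N. (1 - r j)\<^sup>2 * (1 - u j * v j) * P j) - B / (2 * pi) * sinc b\<bar>
        \<le> (K + 3) + 2 * sqrt (B / m)"
      using K[OF B] unfolding P_def[symmetric] N_def[symmetric] by linarith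
    then show ?thesis unfolding r_def u_def v_def P_def N_def .
  qed
  then show ?thesis by blast
qed

section \<open>The refocused profile in the high-frequency limit\<close>

lemma mode_bound_lambda_oc:
  assumes "c > 0" "n1 > 0" "\<omega> > 0"
  shows "mode_bound c n1 d \<omega> * lambda_oc c n1 \<omega> = 2 * pi * d * theta n1"
  using assms unfolding mode_bound_def lambda_oc_def wavenumber_def by simp

lemma theta_pos:
  assumes "n1 > 1"
  shows "theta n1 > 0"
  using assms unfolding theta_def by (simp add: one_less_power)

text \<open>
  The scaling identity \<open>B \<lambda> = 2 \<pi> d \<theta>\<close> has two effects: an offset of \<open>t\<close> units of \<open>\<lambda> / \<theta>\<close> shifts the phase of
  a mode by \<open>2 \<pi> t \<sigma> / B = 2 \<pi> t sin p\<close>, and the normalisation becomes a constant multiple of \<open>1 / B\<close>.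
\<close>

lemma refocused_profile_eq:
  fixes c n1 d x0 \<alpha> dM e1 e2 \<omega> t :: real
  defines "B \<equiv> mode_bound c n1 d \<omega>" and "l \<equiv> lambda_oc c n1 \<omega>"
  defines "C \<equiv> (mirror_upper c n1 \<alpha> dM e2 \<omega> + mirror_lower c n1 \<alpha> dM e1 \<omega>) / d"
  assumes "c > 0" "n1 > 1" "d > 0" "\<omega> > 0" "x0 < d"
    and le: "x0 + l / theta n1 * t \<le> d"
  shows "l powr (1 - \<alpha>) / theta n1 * refocused_profile c n1 d \<alpha> dM e1 e2 x0 \<omega> (x0 + l / theta n1 * t)
    = 2 * pi * (e2 + e1) / d / B * (\<Sum>j = 1..mode_count B.
      (1 - 1 / (1 + B * cos (mode_angle B j)))\<^sup>2 *
      (1 - cos (B * sin (mode_angle B j) * C) *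
         sinc (B * sin (mode_angle B j) * (l powr \<alpha> * (e2 + e1) / d))) *
      (sin (B * sin (mode_angle B j) * (x0 / d)) *
       sin (B * sin (mode_angle B j) * (x0 / d) + 2 * pi * t * sin (mode_angle B j))))"
proof -
  have th: "theta n1 > 0" using theta_pos assms by simp
  have l: "l > 0" unfolding l_def lambda_oc_def using assms by simp
  have Bl: "B * l = 2 * pi * d * theta n1"
    unfolding B_def l_def using assms by (intro mode_bound_lambda_oc) auto
  then have "B * l > 0" using th assms by simp
  then have B: "B > 0" using l by (simp add: zero_less_mult_iff)
  have lB: "l / theta n1 = 2 * pi * d / B" using Bl B th by (simp add: field_simps)
  define w where "w = mirror_upper c n1 \<alpha> dM e2 \<omega> - mirror_lower c n1 \<alpha> dM e1 \<omega>"
  have w: "w = l powr \<alpha> * (e2 + e1)"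
    unfolding w_def mirror_upper_def mirror_lower_def l_def by (simp add: algebra_simps)
  define F where "F j = (1 - 1 / (1 + B * cos (mode_angle B j)))\<^sup>2 *
      (1 - cos (B * sin (mode_angle B j) * C) * sinc (B * sin (mode_angle B j) * (w / d))) *
      (sin (B * sin (mode_angle B j) * (x0 / d)) *
       sin (B * sin (mode_angle B j) * (x0 / d) + 2 * pi * t * sin (mode_angle B j)))" for j
  have summand: "mirror_coeff c n1 d \<alpha> dM e1 e2 \<omega> j * mode_profile c n1 d \<omega> j x0 *
      mode_profile c n1 d \<omega> j (x0 + l / theta n1 * t) = w * (4 / d\<^sup>2) * F j"
    if j: "j \<in> {1..mode_count B}" for j
  proof -
    define A where "A = amplitude c n1 d \<omega> j"
    define s where "s = B * sin (mode_angle B j)"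
    have s: "sigma c n1 d \<omega> j = s"
      unfolding s_def using sigma_eq[of c n1 d \<omega> j] B j unfolding B_def by simp
    have A: "A\<^sup>2 = 2 / d * (1 - 1 / (1 + B * cos (mode_angle B j)))"
      unfolding A_def using amplitude_squared[of c n1 d \<omega> B j] B j assms by simp
    have ph: "s * (x0 + l / theta n1 * t) / d = s * (x0 / d) + 2 * pi * t * sin (mode_angle B j)"
      unfolding lB s_def using B assms by (simp add: field_simps)
    have 1: "mirror_coeff c n1 d \<alpha> dM e1 e2 \<omega> j = w * A\<^sup>2 * (1 - cos (s * C) * sinc (s * (w / d)))"
      unfolding mirror_coeff_def Let_def s A_def[symmetric] w_def C_def ..
    have 2: "mode_profile c n1 d \<omega> j x0 = A * sin (s * (x0 / d))"
      unfolding mode_profile_def Let_def s A_def[symmetric] using assms by simp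
    have 3: "mode_profile c n1 d \<omega> j (x0 + l / theta n1 * t)
        = A * sin (s * (x0 / d) + 2 * pi * t * sin (mode_angle B j))"
      unfolding mode_profile_def Let_def s A_def[symmetric] ph using le by simp
    have "mirror_coeff c n1 d \<alpha> dM e1 e2 \<omega> j * mode_profile c n1 d \<omega> j x0 *
      mode_profile c n1 d \<omega> j (x0 + l / theta n1 * t)
      = w * (A\<^sup>2)\<^sup>2 * (1 - cos (s * C) * sinc (s * (w / d))) * (sin (s * (x0 / d)) *
        sin (s * (x0 / d) + 2 * pi * t * sin (mode_angle B j)))"
      unfolding 1 2 3 power2_eq_square by (simp only: ac_simps)
    also have "\<dots> = w * (4 / d\<^sup>2) * F j"
      unfolding A F_def s_def[symmetric] power_mult_distrib power_divide by simp
    finally show ?thesis .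
  qed
  have "l powr (1 - \<alpha>) / theta n1 * refocused_profile c n1 d \<alpha> dM e1 e2 x0 \<omega> (x0 + l / theta n1 * t)
      = l powr (1 - \<alpha>) / theta n1 * (1 / 4 * (\<Sum>j = 1..mode_count B. w * (4 / d\<^sup>2) * F j))"
  proof -
    have "num_modes c n1 d \<omega> = mode_count B"
      using num_modes_eq[of c n1 d \<omega>] B unfolding B_def by simp
    then show ?thesis unfolding refocused_profile_def by (simp only: sum.cong[OF refl summand])
  qed
  also have "\<dots> = l powr (1 - \<alpha>) * w / theta n1 / d\<^sup>2 * (\<Sum>j = 1..mode_count B. F j)"
    unfolding sum_distrib_left[symmetric] by simp
  also have "l powr (1 - \<alpha>) * w = l * (e2 + e1)"
    unfolding w using l by (simp add: powr_diff)
  also have "l * (e2 + e1) / theta n1 / d\<^sup>2 = l / theta n1 * (e2 + e1) / d\<^sup>2" by simp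
  also have "\<dots> = 2 * pi * (e2 + e1) / d / B"
    unfolding lB using \<open>d > 0\<close> by (simp add: power2_eq_square mult.commute)
  finally show ?thesis unfolding F_def w .
qed

lemma lambda_oc_tendsto_0:
  "((\<lambda>\<omega>. lambda_oc c n1 \<omega>) \<longlongrightarrow> 0) at_top"
proof -
  have "((\<lambda>\<omega>::real. 2 * pi * c / n1 * inverse \<omega>) \<longlongrightarrow> 2 * pi * c / n1 * 0) at_top"
    by (intro tendsto_intros tendsto_inverse_0_at_top filterlim_ident)
  moreover have "(\<lambda>\<omega>. lambda_oc c n1 \<omega>) = (\<lambda>\<omega>::real. 2 * pi * c / n1 * inverse \<omega>)"
    unfolding lambda_oc_def by (auto simp: field_simps)
  ultimately show ?thesis by simp
qed

text \<open>
  The error terms are \<open>1 / B\<close>, of order \<open>\<lambda>\<close>, and \<open>sqrt (B / m) / B = 1 / sqrt (B m)\<close>.  As \<open>m\<close> is of order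
  \<open>\<lambda> powr \<alpha>\<close>, the second is of order \<open>sqrt (\<lambda> powr (1 - \<alpha>))\<close>; here \<open>\<alpha> < 1\<close> is used.
\<close>

lemma refocused_profile_limit:
  fixes c n1 d x0 \<alpha> dM e1 e2 t :: real
  assumes "c > 0" "n1 > 1" "d > 0" "0 < x0" "x0 < d" "\<alpha> < 1" "e1 + e2 > 0"
  shows "((\<lambda>\<omega>. lambda_oc c n1 \<omega> powr (1 - \<alpha>) / theta n1 *
      refocused_profile c n1 d \<alpha> dM e1 e2 x0 \<omega> (x0 + lambda_oc c n1 \<omega> / theta n1 * t))
    \<longlongrightarrow> (e2 + e1) / d * sinc (2 * pi * t)) at_top"
proof -
  let ?l = "\<lambda>\<omega>. lambda_oc c n1 \<omega>"
  let ?E = "\<lambda>\<omega>. ?l \<omega> powr (1 - \<alpha>) / theta n1 *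
      refocused_profile c n1 d \<alpha> dM e1 e2 x0 \<omega> (x0 + ?l \<omega> / theta n1 * t)"
  \<comment> \<open>The constant for which \<open>B \<lambda> = d S\<close>.\<close>
  define S where "S = 2 * pi * theta n1"
  define e where "e = e2 + e1"
  have th: "theta n1 > 0" using theta_pos assms by simp
  have S: "S > 0" and e: "e > 0" unfolding S_def e_def using th assms by auto
  note l0 = lambda_oc_tendsto_0[of c n1]
  obtain K where K: "\<And>B m C. B \<ge> 1 \<Longrightarrow> m > 0 \<Longrightarrow> \<bar>(\<Sum>j = 1..mode_count B.
      (1 - 1 / (1 + B * cos (mode_angle B j)))\<^sup>2 *
      (1 - cos (B * sin (mode_angle B j) * C) * sinc (B * sin (mode_angle B j) * m)) *
      (sin (B * sin (mode_angle B j) * (x0 / d)) *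
       sin (B * sin (mode_angle B j) * (x0 / d) + 2 * pi * t * sin (mode_angle B j))))
      - B / (2 * pi) * sinc (2 * pi * t)\<bar> \<le> K + 2 * sqrt (B / m)"
    using weighted_mode_sum[of "x0 / d" "2 * pi * t"] assms by (auto simp: field_simps)
  define G where "G l = 2 * pi * e / d * (K * (l / (d * S)) + 2 * sqrt (l powr (1 - \<alpha>) / (S * e)))" for l
  have bound: "\<bar>?E \<omega> - e / d * sinc (2 * pi * t)\<bar> \<le> G (?l \<omega>)"
    if w: "\<omega> > 0" and le: "x0 + ?l \<omega> / theta n1 * t \<le> d" and small: "?l \<omega> \<le> d * S" for \<omega>
  proof -
    define l where "l = ?l \<omega>"
    define B where "B = mode_bound c n1 d \<omega>"
    define m where "m = l powr \<alpha> * e / d"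
    have l: "l > 0" unfolding l_def lambda_oc_def using w assms by simp
    have Bl: "B * l = d * S"
      using mode_bound_lambda_oc[of c n1 \<omega> d] w assms unfolding B_def l_def S_def by (simp add: ac_simps)
    then have B': "B = d * S / l" using l by (simp add: field_simps)
    have B: "B \<ge> 1" unfolding B' using small l unfolding l_def by simp
    have m: "m > 0" unfolding m_def using l e assms by simp
    define Z where "Z = (\<Sum>j = 1..mode_count B. (1 - 1 / (1 + B * cos (mode_angle B j)))\<^sup>2 *
      (1 - cos (B * sin (mode_angle B j) *
         ((mirror_upper c n1 \<alpha> dM e2 \<omega> + mirror_lower c n1 \<alpha> dM e1 \<omega>) / d)) *
         sinc (B * sin (mode_angle B j) * m)) *
      (sin (B * sin (mode_angle B j) * (x0 / d)) *
       sin (B * sin (mode_angle B j) * (x0 / d) + 2 * pi * t * sin (mode_angle B j))))"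
    have E: "?E \<omega> = 2 * pi * e / d / B * Z"
      using refocused_profile_eq[OF assms(1-3) w assms(5) le, of \<alpha> dM e1 e2]
      unfolding Z_def m_def l_def B_def e_def .
    have Z: "\<bar>Z - B / (2 * pi) * sinc (2 * pi * t)\<bar> \<le> K + 2 * sqrt (B / m)"
      unfolding Z_def using K[OF B m] .
    have "?E \<omega> - e / d * sinc (2 * pi * t)
        = 2 * pi * e / d / B * (Z - B / (2 * pi) * sinc (2 * pi * t))"
    proof -
      have "2 * pi * e / d / B * (B / (2 * pi) * y) = e / d * y" for y using B by simp
      then show ?thesis unfolding E right_diff_distrib by presburger
    qed
    then have "\<bar>?E \<omega> - e / d * sinc (2 * pi * t)\<bar>
        = 2 * pi * e / d / B * \<bar>Z - B / (2 * pi) * sinc (2 * pi * t)\<bar>"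
      using e assms B by (simp only: abs_mult) simp
    also have "\<dots> \<le> 2 * pi * e / d / B * (K + 2 * sqrt (B / m))"
      using Z e assms B by (intro mult_left_mono) auto
    also have "\<dots> = 2 * pi * e / d * (K * (1 / B) + 2 * (sqrt (B / m) / B))"
      by (simp add: algebra_simps add_divide_distrib)
    also have "1 / B = l / (d * S)" unfolding B' by simp
    also have "sqrt (B / m) / B = sqrt (l powr (1 - \<alpha>) / (S * e))"
    proof -
      have "sqrt (B / m) / B = sqrt (B / m / B\<^sup>2)"
        unfolding real_sqrt_divide[of "B / m"] using B by simp
      also have "B / m / B\<^sup>2 = 1 / (B * m)" using B by (simp add: power2_eq_square)
      also have "\<dots> = l powr (1 - \<alpha>) / (S * e)"
        unfolding B' m_def using l assms by (simp add: powr_diff)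
      finally show ?thesis .
    qed
    finally show ?thesis unfolding G_def l_def .
  qed
  have "((\<lambda>\<omega>. x0 + ?l \<omega> / theta n1 * t) \<longlongrightarrow> x0 + 0 / theta n1 * t) at_top"
    using th by (intro tendsto_intros l0) auto
  then have ev1: "\<forall>\<^sub>F \<omega> in at_top. x0 + ?l \<omega> / theta n1 * t < d"
    using assms by (intro order_tendstoD(2)[where y = "x0 + 0 / theta n1 * t"]) auto
  have ev2: "\<forall>\<^sub>F \<omega> in at_top. ?l \<omega> < d * S"
    using S assms by (intro order_tendstoD(2)[OF l0]) auto
  \<comment> \<open>Near the source the observation point lies in the ocean, so the profile is given by the sine
    branch.\<close>
  have ev: "\<forall>\<^sub>F \<omega> in at_top. norm (?E \<omega> - e / d * sinc (2 * pi * t)) \<le> G (?l \<omega>)"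
    using ev1 ev2 eventually_gt_at_top[of "0::real"]
    by eventually_elim (use bound in auto)
  have lnn: "\<forall>\<^sub>F \<omega> in at_top. 0 \<le> ?l \<omega>"
    using eventually_gt_at_top[of "0::real"]
    by eventually_elim (use assms in \<open>simp add: lambda_oc_def\<close>)
  have "((\<lambda>\<omega>. ?l \<omega> powr (1 - \<alpha>)) \<longlongrightarrow> 0) at_top"
    using assms lnn by (intro tendsto_zero_powrI[OF l0 tendsto_const]) auto
  then have "((\<lambda>\<omega>. G (?l \<omega>)) \<longlongrightarrow>
      2 * pi * e / d * (K * (0 / (d * S)) + 2 * sqrt (0 / (S * e)))) at_top"
    unfolding G_def using S e assms by (intro tendsto_intros l0) auto
  then have "((\<lambda>\<omega>. G (?l \<omega>)) \<longlongrightarrow> 0) at_top" by simp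
  from Lim_null_comparison[OF ev this]
  show ?thesis unfolding e_def by (simp add: LIM_zero_iff)
qed

theorem proposition3p1:
  fixes c n1 d x0 \<alpha> dM e1 e2 :: real
  assumes "c > 0" and "n1 > 1" and "d > 0"
    and "0 < x0" and "x0 < d"
    and "0 \<le> \<alpha>" and "\<alpha> < 1"
    and "0 < dM" and "dM < d" and "e1 > 0" and "e2 > 0"
    and "\<forall>\<^sub>F \<omega> in at_top.
           {mirror_lower c n1 \<alpha> dM e1 \<omega>..mirror_upper c n1 \<alpha> dM e2 \<omega>} \<subseteq> {0..d}"
  shows "(\<forall>t::real.
           ((\<lambda>\<omega>. lambda_oc c n1 \<omega> powr (1 - \<alpha>) / theta n1 *
                 refocused_profile c n1 d \<alpha> dM e1 e2 x0 \<omega>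
                   (x0 + lambda_oc c n1 \<omega> / theta n1 * t))
            \<longlongrightarrow> (e2 + e1) / d * sinc (2 * pi * t)) at_top) \<and>
         (\<forall>t::real. \<bar>t\<bar> = 1 / 2 \<longrightarrow> (e2 + e1) / d * sinc (2 * pi * t) = 0) \<and>
         (\<forall>t::real. \<bar>t\<bar> < 1 / 2 \<longrightarrow> (e2 + e1) / d * sinc (2 * pi * t) \<noteq> 0) \<and>
         (\<forall>\<omega>>0. \<forall>t::real. \<bar>t\<bar> = 1 / 2 \<longrightarrow>
           dist x0 (x0 + lambda_oc c n1 \<omega> / theta n1 * t) = lambda_oc c n1 \<omega> / (2 * theta n1))"
proof (intro conjI allI impI)
  fix t :: real
  show "((\<lambda>\<omega>. lambda_oc c n1 \<omega> powr (1 - \<alpha>) / theta n1 *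
      refocused_profile c n1 d \<alpha> dM e1 e2 x0 \<omega> (x0 + lambda_oc c n1 \<omega> / theta n1 * t))
    \<longlongrightarrow> (e2 + e1) / d * sinc (2 * pi * t)) at_top"
    using assms by (intro refocused_profile_limit) auto
next
  fix t :: real assume "\<bar>t\<bar> = 1 / 2"
  then have "t = 1 / 2 \<or> t = - (1 / 2)" by linarith
  then have "2 * pi * t = pi \<or> 2 * pi * t = - pi" by auto
  then show "(e2 + e1) / d * sinc (2 * pi * t) = 0" by (elim disjE) (simp_all only: sin_minus sin_pi, auto)
next
  fix t :: real assume t: "\<bar>t\<bar> < 1 / 2"
  have "sinc (2 * pi * t) \<noteq> 0"
  proof (cases "t = 0")
    case False
    have "\<bar>2 * pi * t\<bar> < pi" using t by (simp add: abs_mult)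
    then have "- pi < 2 * pi * t" "2 * pi * t < pi" by linarith+
    then have "sin (2 * pi * t) \<noteq> 0" using False sin_eq_0_pi[of "2 * pi * t"] by fastforce
    then show ?thesis using False by simp
  qed simp
  then show "(e2 + e1) / d * sinc (2 * pi * t) \<noteq> 0" using assms by simp
next
  fix \<omega> t :: real assume "\<omega> > 0" "\<bar>t\<bar> = 1 / 2"
  have "lambda_oc c n1 \<omega> / theta n1 > 0"
    using assms \<open>\<omega> > 0\<close> theta_pos unfolding lambda_oc_def by simp
  moreover have "dist x0 (x0 + lambda_oc c n1 \<omega> / theta n1 * t) = \<bar>lambda_oc c n1 \<omega> / theta n1 * t\<bar>"
    by (simp add: dist_real_def)
  ultimately have "dist x0 (x0 + lambda_oc c n1 \<omega> / theta n1 * t) = lambda_oc c n1 \<omega> / theta n1 * \<bar>t\<bar>"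
    by (simp only: abs_mult abs_of_pos)
  then show "dist x0 (x0 + lambda_oc c n1 \<omega> / theta n1 * t) = lambda_oc c n1 \<omega> / (2 * theta n1)"
    unfolding \<open>\<bar>t\<bar> = 1 / 2\<close> by simp
qed

end
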